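(* Let $\mathfrak{g}=(V,[\,,])$ be a complex metabelian filiform Lie algebra of dimension $n\ge4$. Then there exists a CPA-structure $(V,\cdot)$ on $\mathfrak{g}$ which is not associative, i.e. for which $\mathfrak{g}\cdot[\mathfrak{g},\mathfrak{g}]\ne0$.
   Context: A commutative post-Lie algebra structure (CPA-structure) on a Lie algebra $\mathfrak{g}=(V,[\,,])$ is a bilinear product $x\cdot y$ on $V$ such that for all $x,y,z\in V$: $x\cdot y=y\cdot x$; $[x,y]\cdot z=x\cdot(y\cdot z)-y\cdot(x\cdot z)$; $x\cdot[y,z]=[x\cdot y,z]+[y,x\cdot z]$. It is called associative if $\mathfrak{g}\cdot[\mathfrak{g},\mathfrak{g}]=0$. A Lie algebra is metabelian if it is solvable of class at most $2$, i.e. $[[\mathfrak{g},\mathfrak{g}],[\mathfrak{g},\mathfrak{g}]]=0$. A finite-dimensional Lie algebra is filiform if it is nilpotent of class $\dim(\mathfrak{g})-1$, where with $\mathfrak{g}^0=\mathfrak{g}$, $\mathfrak{g}^i=[\mathfrak{g},\mathfrak{g}^{i-1}]$, the nilpotency class is the smallest $k\ge1$ with $\mathfrak{g}^k=0$. *)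

theory Defs
  imports Complex_Main
begin

locale lie_algebra = vector_space scale
  for scale :: "'k::field \<Rightarrow> 'v::ab_group_add \<Rightarrow> 'v" +
  fixes bracket :: "'v \<Rightarrow> 'v \<Rightarrow> 'v"
  assumes bracket_linear_left: "\<And>y. Vector_Spaces.linear scale scale (\<lambda>x. bracket x y)"
    and bracket_linear_right: "\<And>x. Vector_Spaces.linear scale scale (bracket x)"
    and bracket_alternating: "\<And>x. bracket x x = 0"
    and jacobi: "\<And>x y z. bracket x (bracket y z) + bracket y (bracket z x) + bracket z (bracket x y) = 0"

context vector_space
begin

text \<open>For a bilinear product on the space, the product of two subspaces is the subspace spanned by
  the products of their elements.\<close>

definition product_space :: "('b \<Rightarrow> 'b \<Rightarrow> 'b) \<Rightarrow> 'b set \<Rightarrow> 'b set \<Rightarrow> 'b set" where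
  "product_space m A B = span {m x y | x y. x \<in> A \<and> y \<in> B}"

end

context lie_algebra
begin

definition derived_algebra :: "'v set" where
  "derived_algebra = product_space bracket UNIV UNIV"

definition metabelian :: bool where
  "metabelian \<longleftrightarrow> product_space bracket derived_algebra derived_algebra = {0}"

primrec lower_central :: "nat \<Rightarrow> 'v set" where
  "lower_central 0 = UNIV"
| "lower_central (Suc i) = product_space bracket UNIV (lower_central i)"

definition nilpotent :: bool where
  "nilpotent \<longleftrightarrow> (\<exists>k\<ge>1. lower_central k = {0})"

text \<open>Only meaningful for nilpotent Lie algebras.\<close>

definition nilpotency_class :: nat where
  "nilpotency_class = (LEAST k. k \<ge> 1 \<and> lower_central k = {0})"

text \<open>The class is \<open>dim - 1\<close>, written without truncated subtraction. Finite dimensionality is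
  stated separately because \<^const>\<open>dim\<close> is 0 on infinite-dimensional spaces.\<close>

definition filiform :: bool where
  "filiform \<longleftrightarrow> (\<exists>B. finite B \<and> span B = UNIV) \<and> nilpotent \<and> nilpotency_class + 1 = dim UNIV"

end

locale cpa_structure = lie_algebra scale bracket
  for scale :: "'k::field \<Rightarrow> 'v::ab_group_add \<Rightarrow> 'v" and bracket :: "'v \<Rightarrow> 'v \<Rightarrow> 'v" +
  fixes prd :: "'v \<Rightarrow> 'v \<Rightarrow> 'v"
  assumes prd_linear_left: "\<And>y. Vector_Spaces.linear scale scale (\<lambda>x. prd x y)"
    and prd_linear_right: "\<And>x. Vector_Spaces.linear scale scale (prd x)"
    and prd_commute: "\<And>x y. prd x y = prd y x"
    and prd_bracket_left: "\<And>x y z. prd (bracket x y) z = prd x (prd y z) - prd y (prd x z)"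
    and prd_bracket_right: "\<And>x y z. prd x (bracket y z) = bracket (prd x y) z + bracket y (prd x z)"
begin

definition associative :: bool where
  "associative \<longleftrightarrow> product_space prd UNIV derived_algebra = {0}"

end

end

theory Submission imports Defs
begin

text \<open>Write \<open>g\<^sup>i\<close> for the lower central series. In a metabelian filiform algebra there are \<open>e1, e2\<close>
  spanning a complement of \<open>g\<^sup>1\<close> such that \<open>w = [e1, e2]\<close> satisfies \<open>g\<^sup>2 = \<langle>[e1, w]\<rangle> + g\<^sup>3\<close>. The
  operators \<open>ad e1\<close> and \<open>ad e2\<close> commute on \<open>g\<^sup>1\<close>, so \<open>ad e1\<close> maps \<open>g\<^sup>1\<close> onto \<open>g\<^sup>2\<close>, and there is
  \<open>q \<in> g\<^sup>1\<close> with \<open>[e1, q] = [e2, w]\<close>. The commutative product given for \<open>u, v \<in> g\<^sup>1\<close> by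
  \<open>e1 e1 = 0\<close>, \<open>e1 e2 = w\<close>, \<open>e2 e2 = 2 q\<close>, \<open>ei u = [ei, u]\<close>, \<open>u v = 0\<close>
  is a CPA-structure, and \<open>e1 w = [e1, w] \<noteq> 0\<close>.\<close>

section \<open>Bracket calculus and the lower central series\<close>

lemma (in vector_space) decompose_insert2:
  assumes "subspace S" "v \<in> span (insert x (insert y S))"
  shows "\<exists>a b. v - scale a x - scale b y \<in> S"
  using assms(2) unfolding span_breakdown_eq span_eq_iff[THEN iffD2, OF assms(1)] by blast

context lie_algebra
begin

lemmas bracket_add_left =
  module_hom.add[OF bracket_linear_left[folded module_hom_iff_linear]]
lemmas bracket_scale_left =
  module_hom.scale[OF bracket_linear_left[folded module_hom_iff_linear]]
lemmas bracket_diff_left =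
  module_hom.diff[OF bracket_linear_left[folded module_hom_iff_linear]]
lemmas bracket_zero_left =
  module_hom.zero[OF bracket_linear_left[folded module_hom_iff_linear]]
lemmas bracket_add_right =
  module_hom.add[OF bracket_linear_right[folded module_hom_iff_linear]]
lemmas bracket_scale_right =
  module_hom.scale[OF bracket_linear_right[folded module_hom_iff_linear]]
lemmas bracket_diff_right =
  module_hom.diff[OF bracket_linear_right[folded module_hom_iff_linear]]
lemmas bracket_zero_right =
  module_hom.zero[OF bracket_linear_right[folded module_hom_iff_linear]]
lemmas bracket_minus_right =
  module_hom.neg[OF bracket_linear_right[folded module_hom_iff_linear]]

lemmas bracket_simps = bracket_add_left bracket_scale_left bracket_add_right bracket_scale_right
  bracket_diff_left bracket_diff_right bracket_zero_left bracket_zero_right bracket_alternating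

lemma bracket_commute: "bracket x y = - bracket y x"
  using bracket_alternating[of "x + y"] unfolding bracket_add_left bracket_add_right
  by (simp add: bracket_alternating eq_neg_iff_add_eq_0 add.commute)

text \<open>The Jacobi identity in the form needed for commuting adjoint maps.\<close>

lemma bracket_derivation: "bracket x (bracket y z) = bracket (bracket x y) z + bracket y (bracket x z)"
proof -
  have "bracket y (bracket z x) = - bracket y (bracket x z)"
    unfolding bracket_commute[of z x] by (rule bracket_minus_right)
  then have "bracket x (bracket y z) + - bracket y (bracket x z) + - bracket (bracket x y) z = 0"
    using jacobi[of x y z] unfolding bracket_commute[of z "bracket x y"] by (simp only:)
  then show ?thesis
    by (simp add: algebra_simps)
qed

lemma scale_2: "scale 2 x = x + x"
  using scale_left_distrib[of 1 1 x] by simp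

lemma scale_double: "scale (2 * c) x = scale c x + scale c x"
  unfolding mult_2 by (rule scale_left_distrib)

lemma product_space_member: "x \<in> A \<Longrightarrow> y \<in> B \<Longrightarrow> m x y \<in> product_space m A B"
  unfolding product_space_def by (rule span_base) blast

lemma product_space_least:
  assumes "subspace S" "\<And>x y. x \<in> A \<Longrightarrow> y \<in> B \<Longrightarrow> m x y \<in> S"
  shows "product_space m A B \<subseteq> S"
  unfolding product_space_def using assms by (intro span_minimal) auto

lemma subspace_lower_central: "subspace (lower_central k)"
  by (cases k) (auto simp: product_space_def)

lemma lower_central_member: "y \<in> lower_central k \<Longrightarrow> bracket x y \<in> lower_central (Suc k)"
  by (simp add: product_space_member)

lemma derived_algebra_eq: "derived_algebra = lower_central 1"
  by (simp add: derived_algebra_def)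

lemma lower_central_Suc_subset: "lower_central (Suc k) \<subseteq> lower_central k"
proof (induction k)
  case (Suc k)
  show ?case
    unfolding lower_central.simps(2)[of "Suc k"]
    using Suc subspace_lower_central lower_central_member by (intro product_space_least) blast+
qed simp

lemma lower_central_antimono: "j \<le> k \<Longrightarrow> lower_central k \<subseteq> lower_central j"
  by (rule lift_Suc_antimono_le[of lower_central]) (use lower_central_Suc_subset in auto)

text \<open>Each term of the series is determined by its predecessor, so after one repetition the
  series is constant, and nilpotency leaves only zero as its value.\<close>

lemma lower_central_stable:
  assumes "nilpotent" "lower_central (Suc k) = lower_central k"
  shows "lower_central k = {0}"
proof -
  have st: "lower_central (k + j) = lower_central k" for j
    using assms(2) by (induction j) auto
  obtain m where m: "lower_central m = {0}"
    using assms(1) unfolding nilpotent_def by blast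
  have "lower_central k \<subseteq> {0}"
    using st[of m] lower_central_antimono[of m "k + m"] m by simp
  then show ?thesis
    using subspace_0[OF subspace_lower_central, of k] by blast
qed

lemma metabelian_bracket_eq_0:
  "metabelian \<Longrightarrow> x \<in> derived_algebra \<Longrightarrow> y \<in> derived_algebra \<Longrightarrow> bracket x y = 0"
  unfolding metabelian_def using product_space_member[of x derived_algebra y derived_algebra bracket]
  by simp

text \<open>Modulo \<open>g\<^sup>2\<close> the bracket ignores components in
  \<open>g\<^sup>1\<close>, so only the determinant of the coefficients of \<open>x\<close> and
  \<open>y\<close> survives. The instance \<open>x = y\<close> will show that
  \<open>g\<^sup>1\<close> does not have codimension 1.\<close>

lemma derived_algebra_generated:
  assumes "span (insert x (insert y derived_algebra)) = UNIV"
  shows "lower_central 1 \<subseteq> span (insert (bracket x y) (lower_central 2))" (is "_ \<subseteq> ?S")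
proof -
  have sub: "subspace derived_algebra"
    by (simp add: derived_algebra_eq subspace_lower_central del: lower_central.simps)
  have dec: "\<exists>a b u. v = scale a x + scale b y + u \<and> u \<in> derived_algebra" for v
  proof -
    obtain a b where "v - scale a x - scale b y \<in> derived_algebra"
      using decompose_insert2[OF sub, of v x y] assms by auto
    then show ?thesis
      by (intro exI[of _ a] exI[of _ b] exI[of _ "v - scale a x - scale b y"]) simp
  qed
  have w: "bracket x y \<in> ?S" by (simp add: span_base)
  have d2: "bracket v u \<in> ?S" if "u \<in> derived_algebra" for u v
    using lower_central_member[of u 1 v] that
    by (intro span_base) (simp add: derived_algebra_eq numeral_2_eq_2)
  have mem: "bracket v v' \<in> ?S" for v v'
  proof -
    obtain a b u where v: "v = scale a x + scale b y + u" and u: "u \<in> derived_algebra"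
      using dec by blast
    obtain c d u' where v': "v' = scale c x + scale d y + u'" and u': "u' \<in> derived_algebra"
      using dec by blast
    \<comment> \<open>The terms with \<open>u\<close> and \<open>u'\<close> carry them in the second
      slot, where \<open>d2\<close> applies.\<close>
    have "bracket v v' = scale (a * d - b * c) (bracket x y) + bracket v u' - bracket (v' - u') u"
      unfolding v v' using bracket_commute[of y x] bracket_commute[of u x] bracket_commute[of u y]
      by (simp add: bracket_simps algebra_simps)
    then show ?thesis
      using w d2[OF u] d2[OF u'] by (simp add: span_add span_diff span_scale)
  qed
  have "product_space bracket UNIV UNIV \<subseteq> ?S"
    by (rule product_space_least[OF subspace_span mem])
  then show ?thesis by simp
qed

section \<open>The product attached to coordinates modulo the derived algebra\<close>

text \<open>The coordinates \<open>\<alpha>, \<beta>\<close> are taken modulo the derived algebra. The left multiplication by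
  \<open>x = \<alpha> e1 + \<beta> e2 + u\<close> is \<open>ad (\<alpha> e1 + \<beta> e2 - u)\<close> corrected by a derivation killing the derived
  algebra; the condition on \<open>q\<close> is what makes this correction a derivation.\<close>

lemma cpa_structure_of_coordinates:
  fixes \<alpha> \<beta> :: "'v \<Rightarrow> 'k" and e1 e2 q :: 'v
  defines "prd \<equiv> \<lambda>x y. bracket (scale 2 (scale (\<alpha> x) e1 + scale (\<beta> x) e2) - x) y
      + scale (2 * \<beta> x) (scale (\<alpha> y) (bracket e1 e2) + scale (\<beta> y) q)"
  assumes met: "metabelian"
    and \<alpha>: "Vector_Spaces.linear scale (*) \<alpha>" "\<And>u. u \<in> derived_algebra \<Longrightarrow> \<alpha> u = 0"
    and \<beta>: "Vector_Spaces.linear scale (*) \<beta>" "\<And>u. u \<in> derived_algebra \<Longrightarrow> \<beta> u = 0"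
    and coord: "\<And>x. x - scale (\<alpha> x) e1 - scale (\<beta> x) e2 \<in> derived_algebra"
    and q: "q \<in> derived_algebra" "bracket e1 q = bracket e2 (bracket e1 e2)"
  shows "cpa_structure scale bracket prd"
proof -
  define w where "w = bracket e1 e2"
  \<comment> \<open>\<open>\<sigma> x\<close> is \<open>x\<close> with the sign of its remainder in
    the derived algebra reversed. Left multiplication by \<open>x\<close> is the adjoint map of
    \<open>\<sigma> x\<close> plus \<open>2 * \<beta> x\<close> times the linear map
    \<open>s\<close>.\<close>
  define \<sigma> where "\<sigma> x = scale 2 (scale (\<alpha> x) e1 + scale (\<beta> x) e2) - x" for x
  define s where "s y = scale (\<alpha> y) w + scale (\<beta> y) q" for y
  have prd: "prd x y = bracket (\<sigma> x) y + (scale (\<beta> x) (s y) + scale (\<beta> x) (s y))" for x y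
    by (simp add: prd_def \<sigma>_def s_def w_def scale_double)
  note add = module_hom.add[OF \<alpha>(1)[folded module_hom_iff_linear]] module_hom.add[OF \<beta>(1)[folded module_hom_iff_linear]]
  note sc = module_hom.scale[OF \<alpha>(1)[folded module_hom_iff_linear]] module_hom.scale[OF \<beta>(1)[folded module_hom_iff_linear]]
  have sub: "subspace derived_algebra"
    by (simp add: derived_algebra_def product_space_def)
  have br: "bracket x y \<in> derived_algebra" for x y
    by (simp add: derived_algebra_def product_space_member)
  \<comment> \<open>The remainder of \<open>x\<close> acts as zero on the derived algebra because
    the algebra is metabelian.\<close>
  have act: "bracket x u = scale (\<alpha> x) (bracket e1 u) + scale (\<beta> x) (bracket e2 u)"
    if "u \<in> derived_algebra" for x u
    using metabelian_bracket_eq_0[OF met coord that, of x] by (simp add: bracket_simps algebra_simps)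
  have \<sigma>_act: "bracket (\<sigma> x) u = bracket x u" if "u \<in> derived_algebra" for x u
    unfolding \<sigma>_def using act[OF that, of x] by (simp add: bracket_simps scale_2)
  have s_in: "s y \<in> derived_algebra" for y
    unfolding s_def w_def using br q(1) sub by (simp add: subspace_add subspace_scale)
  have prd_in: "prd x y \<in> derived_algebra" for x y
    unfolding prd using br s_in sub by (simp add: subspace_add subspace_scale)
  have s_0: "s u = 0" if "u \<in> derived_algebra" for u
    using that by (simp add: s_def \<alpha> \<beta>)
  have prd_der: "prd x u = bracket x u" if "u \<in> derived_algebra" for x u
    using that by (simp add: prd s_0 \<sigma>_act)
  \<comment> \<open>Here the equation for \<open>q\<close> enters: it turns the \<open>q\<close>
    term into \<open>\<beta> z\<close> times \<open>[e2, w]\<close>.\<close>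
  have e1_s: "bracket e1 (s z) = bracket z w" for z
    using act[OF br, of z e1 e2] q(2) by (simp add: s_def w_def bracket_simps)
  \<comment> \<open>Expanded, both sides have coefficient \<open>\<alpha> y * \<alpha> z\<close> at
    \<open>[e1, w]\<close>, \<open>\<alpha> y * \<beta> z + \<beta> y * \<alpha> z\<close> at
    \<open>[e2, w]\<close> and \<open>\<beta> y * \<beta> z\<close> at \<open>[e2, q]\<close>. As
    \<open>s\<close> kills brackets, this symmetry says that \<open>s\<close> is a
    derivation.\<close>
  have s_sym: "bracket y (s z) = bracket z (s y)" for y z
  proof -
    have y: "bracket y (s z) = scale (\<alpha> y) (bracket z w) + scale (\<beta> y) (bracket e2 (s z))" for y z
      using act[OF s_in, of y z] e1_s by simp
    have w: "bracket z w = scale (\<alpha> z) (bracket e1 w) + scale (\<beta> z) (bracket e2 w)" for z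
      unfolding w_def by (rule act[OF br])
    have e2: "bracket e2 (s z) = scale (\<alpha> z) (bracket e2 w) + scale (\<beta> z) (bracket e2 q)" for z
      by (simp add: s_def bracket_simps)
    show ?thesis
      unfolding y[of y z] y[of z y] w[of y] w[of z] e2 by (simp add: algebra_simps)
  qed
  define r where "r x = x - scale (\<alpha> x) e1 - scale (\<beta> x) e2" for x
  have split: "x = scale (\<alpha> x) e1 + scale (\<beta> x) e2 + r x" for x
    by (simp add: r_def)
  have \<sigma>_split: "\<sigma> x = scale (\<alpha> x) e1 + scale (\<beta> x) e2 - r x" for x
    unfolding \<sigma>_def r_def scale_2 by (simp add: algebra_simps)
  have rr: "bracket (r x) (r y) = 0" for x y
    unfolding r_def by (rule metabelian_bracket_eq_0[OF met coord coord])
  \<comment> \<open>The mixed terms with one remainder have opposite signs in the two brackets and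
    cancel.\<close>
  have \<sigma>2: "bracket (\<sigma> x) (\<sigma> y) + bracket x y
      = scale (\<alpha> x * \<beta> y - \<beta> x * \<alpha> y) w + scale (\<alpha> x * \<beta> y - \<beta> x * \<alpha> y) w" for x y
  proof -
    have "bracket x y = bracket (scale (\<alpha> x) e1 + scale (\<beta> x) e2 + r x)
        (scale (\<alpha> y) e1 + scale (\<beta> y) e2 + r y)"
      by (simp flip: split)
    then show ?thesis
      unfolding \<sigma>_split using bracket_commute[of e2 e1]
      by (simp add: rr w_def bracket_simps algebra_simps)
  qed
  \<comment> \<open>The sign in \<open>\<sigma>\<close> makes the terms with remainders symmetric.
    The antisymmetric part, a determinant times \<open>w\<close>, is cancelled by the
    \<open>w\<close> term of the correction; the \<open>q\<close> term is symmetric.\<close>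
  have commute: "prd x y = prd y x" for x y
  proof -
    have expand: "prd x y = bracket (scale (\<alpha> x) e1 + scale (\<beta> x) e2 - r x)
        (scale (\<alpha> y) e1 + scale (\<beta> y) e2 + r y) + (scale (\<beta> x) (s y) + scale (\<beta> x) (s y))" for x y
      by (simp add: prd flip: split \<sigma>_split)
    show ?thesis
      unfolding expand[of x y] expand[of y x] s_def w_def
      using bracket_commute[of e2 e1] bracket_commute[of "r x" e1] bracket_commute[of "r x" e2]
        bracket_commute[of "r y" e1] bracket_commute[of "r y" e2]
      by (simp add: rr bracket_simps algebra_simps)
  qed
  have left: "Vector_Spaces.linear scale scale (prd x)" for x
    by unfold_locales (simp_all add: prd s_def add sc bracket_simps algebra_simps)
  show ?thesis
  proof (intro cpa_structure.intro lie_algebra_axioms cpa_structure_axioms.intro)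
    show "prd x y = prd y x" for x y by (rule commute)
    show "Vector_Spaces.linear scale scale (prd x)" for x by (rule left)
    then show "Vector_Spaces.linear scale scale (\<lambda>x. prd x y)" for y
      by (subst commute)
  next
    fix x y z
    let ?c = "\<alpha> x * \<beta> y - \<beta> x * \<alpha> y"
    \<comment> \<open>Products lie in the derived algebra, so \<open>s\<close> kills the inner
      product and the outer correction disappears.\<close>
    have twice: "prd x (prd y z) = bracket (\<sigma> x) (bracket (\<sigma> y) z)
        + (scale (\<beta> y) (bracket x (s z)) + scale (\<beta> y) (bracket x (s z)))" for x y
      using \<sigma>_act[OF s_in, of x z]
      by (simp add: prd[of x] s_0[OF prd_in]) (simp add: prd bracket_simps)
    \<comment> \<open>The \<open>e2\<close> components cancel, and \<open>e1_s\<close> rewrites what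
      is left.\<close>
    have act_s: "scale (\<beta> y) (bracket x (s z)) - scale (\<beta> x) (bracket y (s z)) = scale ?c (bracket z w)"
      using act[OF s_in, of x z] act[OF s_in, of y z] e1_s by (simp add: algebra_simps)
    have double: "bracket (bracket x y) z
        = - bracket (bracket (\<sigma> x) (\<sigma> y)) z - (scale ?c (bracket z w) + scale ?c (bracket z w))"
    proof -
      have "bracket x y = scale ?c w + scale ?c w - bracket (\<sigma> x) (\<sigma> y)"
        using \<sigma>2[of x y] by (simp add: algebra_simps)
      then show ?thesis
        by (simp only: bracket_simps bracket_commute[of w z]) simp
    qed
    have der: "bracket (\<sigma> x) (bracket (\<sigma> y) z) - bracket (\<sigma> y) (bracket (\<sigma> x) z)
        = bracket (bracket (\<sigma> x) (\<sigma> y)) z"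
      using bracket_derivation[of "\<sigma> x" "\<sigma> y" z] by simp
    \<comment> \<open>By commutativity, an element of the derived algebra multiplies by minus its
      adjoint map.\<close>
    have left: "prd (bracket x y) z = - bracket (bracket x y) z"
      using commute[of "bracket x y" z] prd_der[OF br] bracket_commute[of z "bracket x y"] by simp
    let ?d = "scale (\<beta> y) (bracket x (s z)) - scale (\<beta> x) (bracket y (s z))"
    have "prd x (prd y z) - prd y (prd x z)
        = bracket (\<sigma> x) (bracket (\<sigma> y) z) - bracket (\<sigma> y) (bracket (\<sigma> x) z) + (?d + ?d)"
      unfolding twice[of x y] twice[of y x] by (simp add: algebra_simps)
    then show "prd (bracket x y) z = prd x (prd y z) - prd y (prd x z)"
      unfolding act_s der left double by simp
    have "bracket (s y) z = - bracket y (s z)"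
      using s_sym[of y z] bracket_commute[of "s y" z] by simp
    then have "bracket (prd x y) z + bracket y (prd x z)
        = bracket (bracket (\<sigma> x) y) z + bracket y (bracket (\<sigma> x) z)"
      by (simp add: prd bracket_simps)
    also have "\<dots> = prd x (bracket y z)"
      unfolding bracket_derivation[of "\<sigma> x" y z, symmetric] prd s_0[OF br] by simp
    finally show "prd x (bracket y z) = bracket (prd x y) z + bracket y (prd x z)" by (rule sym)
  qed
qed

section \<open>Dimensions and adapted generators in the filiform case\<close>

text \<open>A repetition at \<open>k\<close> would make the series vanish there, which is too early
  for class \<open>dim - 1\<close>.\<close>

lemma lower_central_strict:
  assumes "filiform" "Suc k < dim UNIV"
  shows "lower_central (Suc k) \<subset> lower_central k"
proof -
  have fil: "nilpotent" "nilpotency_class + 1 = dim UNIV"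
    using assms(1) by (simp_all add: filiform_def)
  have "lower_central k \<noteq> lower_central (Suc k)"
  proof
    assume "lower_central k = lower_central (Suc k)"
    then have z: "lower_central k = {0}" "lower_central (Suc k) = {0}"
      using lower_central_stable[OF fil(1), of k] by metis+
    \<comment> \<open>The class is at least 1 by definition. The remaining case \<open>k = 0\<close>
      would give a zero space of dimension 2.\<close>
    have "lower_central (max 1 k) = {0}"
      using z by (cases "k = 0") (auto simp: max_def simp del: lower_central.simps)
    then have "nilpotency_class \<le> max 1 k"
      unfolding nilpotency_class_def by (intro Least_le) simp
    then have "k = 0" "dim UNIV = 2"
      using fil(2) assms(2) by (auto simp: max_def split: if_splits)
    then have "UNIV = {0::'v}"
      using z(1) by simp
    then have "dim (UNIV :: 'v set) = 0"
      using dim_le_card[of UNIV "{}"] by simp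
    then show False using \<open>dim UNIV = 2\<close> by simp
  qed
  then show ?thesis using lower_central_Suc_subset[of k] by blast
qed

text \<open>Strict descent forces codimension 2 for \<open>g\<^sup>1\<close> and leaves at most one
  dimension for \<open>g\<^sup>2\<close> modulo \<open>g\<^sup>3\<close>. This quotient is spanned
  by \<open>[x, w]\<close> and \<open>[y, w]\<close> with \<open>w = [x, y]\<close>; one of them is
  nonzero there, and \<open>x\<close> and \<open>y\<close> are swapped if necessary.\<close>

lemma adapted_pair_exists:
  assumes "metabelian" "filiform" "dim UNIV \<ge> 4"
  obtains e1 e2 where "e1 \<notin> derived_algebra" "e2 \<notin> span (insert e1 derived_algebra)"
    "span (insert e2 (insert e1 derived_algebra)) = UNIV"
    "lower_central 2 = span (insert (bracket e1 (bracket e1 e2)) (lower_central 3))"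
    "bracket e1 (bracket e1 e2) \<noteq> 0"
proof -
  obtain B0 where B0: "finite B0" "span B0 = UNIV"
    using assms(2) unfolding filiform_def by blast
  obtain B where B: "B \<subseteq> B0" "independent B" "B0 \<subseteq> span B"
    by (rule maximal_independent_subset)
  have "span B = UNIV"
    using span_minimal[OF B(3) subspace_span] B0(2) by auto
  then interpret fd: finite_dimensional_vector_space scale B
    using B B0(1) by unfold_locales (auto intro: finite_subset)
  note [simp del] = lower_central.simps fd.dim_UNIV
  define n where "n = dim (UNIV :: 'v set)"
  have n: "n \<ge> 4" using assms(3) by (simp add: n_def)
  have span_lc: "span (lower_central k) = lower_central k" for k
    by (simp add: span_eq_iff subspace_lower_central)
  have strict: "lower_central (Suc k) \<subset> lower_central k" if "Suc k < n" for k
    using lower_central_strict[OF assms(2)] that by (simp add: n_def)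
  have decrease: "dim (lower_central (Suc k)) < dim (lower_central k)" if "Suc k < n" for k
    using fd.dim_psubset[of "lower_central (Suc k)" "lower_central k"] strict[OF that]
    by (simp add: span_lc)
  \<comment> \<open>Counting from the term with index \<open>n - 1\<close> upwards, each strict
    inclusion adds at least one dimension.\<close>
  have ge: "j \<le> dim (lower_central (n - 1 - j))" if "j < n" for j
    using that
  proof (induction j)
    case (Suc j)
    then have "Suc (n - 1 - Suc j) = n - 1 - j" by simp
    then show ?case
      using Suc decrease[of "n - 1 - Suc j"] by auto
  qed simp
  have der: "derived_algebra = lower_central 1"
    by (rule derived_algebra_eq)
  obtain x where x: "x \<notin> lower_central 1"
    using strict[of 0] n by (auto simp: lower_central.simps(1))
  \<comment> \<open>A single generator would give \<open>g\<^sup>1 = g\<^sup>2\<close>, since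
    \<open>[x, x] = 0\<close>.\<close>
  have "span (insert x (lower_central 1)) \<noteq> UNIV"
  proof
    assume "span (insert x (lower_central 1)) = UNIV"
    then have "lower_central 1 \<subseteq> lower_central 2"
      using derived_algebra_generated[of x x]
      by (simp add: der bracket_alternating span_insert_0 span_lc)
    then show False using strict[of 1] n by (simp add: numeral_2_eq_2)
  qed
  then obtain y where y: "y \<notin> span (insert x (lower_central 1))" by blast
  have dim2: "dim (insert y (insert x (lower_central 1))) = dim (lower_central 1) + 2"
    using x y by (simp add: fd.dim_insert span_lc)
  moreover have "n - 2 \<le> dim (lower_central 1)"
  proof -
    have "n - 1 - (n - 2) = 1" using n by simp
    then show ?thesis using ge[of "n - 2"] n by simp
  qed
  ultimately have "dim (insert y (insert x (lower_central 1))) \<ge> n" by simp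
  then have full: "span (insert y (insert x (lower_central 1))) = UNIV"
    using fd.subspace_dim_equal[OF subspace_span subspace_UNIV, of "insert y (insert x (lower_central 1))"]
    by (simp add: n_def)
  then have "dim (lower_central 1) + 2 = n"
    using dim2 dim_span[of "insert y (insert x (lower_central 1))"] by (simp add: n_def)
  then have "dim (lower_central 2) + 3 \<le> n"
    using decrease[of 1] n by (simp add: numeral_2_eq_2)
  moreover have "n - 4 \<le> dim (lower_central 3)"
  proof -
    have "n - 1 - (n - 4) = 3" using n by simp
    then show ?thesis using ge[of "n - 4"] n by simp
  qed
  ultimately have codim: "dim (lower_central 2) \<le> dim (lower_central 3) + 1"
    using n by simp
  have sub32: "lower_central 3 \<subseteq> lower_central 2"
    by (rule lower_central_antimono) simp
  have mem2: "bracket z (bracket x y) \<in> lower_central 2" for x y z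
    by (simp add: numeral_2_eq_2 lower_central_member lower_central.simps(1))
  have gen: "lower_central 2 = span (insert (bracket z (bracket x y)) (lower_central 3))"
    if "bracket z (bracket x y) \<notin> lower_central 3" for x y z
  proof (rule fd.subspace_dim_equal[symmetric])
    show "span (insert (bracket z (bracket x y)) (lower_central 3)) \<subseteq> lower_central 2"
      using mem2 sub32 by (intro span_minimal subspace_lower_central) auto
    show "dim (lower_central 2) \<le> dim (span (insert (bracket z (bracket x y)) (lower_central 3)))"
      using codim that by (simp add: fd.dim_insert span_lc)
  qed (auto intro: subspace_lower_central)
  have nz: "bracket z (bracket x y) \<noteq> 0" if "bracket z (bracket x y) \<notin> lower_central 3" for x y z
    using that subspace_0[OF subspace_lower_central, of 3] by auto
  show thesis
  proof (cases "bracket x (bracket x y) \<in> lower_central 3")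
    case False
    then show thesis
      using that[of x y] x y full gen nz unfolding der by blast
  next
    case True
    \<comment> \<open>Otherwise both \<open>[x, w]\<close> and \<open>[y, w]\<close> lie in
      \<open>g\<^sup>3\<close>. Since \<open>w\<close> spans \<open>g\<^sup>1\<close> modulo
      \<open>g\<^sup>2\<close>, every bracket with \<open>g\<^sup>1\<close> would then lie in
      \<open>g\<^sup>3\<close>.\<close>
    have yx: "bracket y (bracket y x) \<notin> lower_central 3"
    proof
      assume yx: "bracket y (bracket y x) \<in> lower_central 3"
      have "lower_central 2 \<subseteq> lower_central 3"
      proof -
        have "bracket v z \<in> lower_central 3" if z: "z \<in> lower_central 1" for v z
        proof -
          define w where "w = bracket x y"
          have "z \<in> span (insert w (lower_central 2))"
            using derived_algebra_generated[of x y] full z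
            by (auto simp: der w_def insert_commute)
          then obtain k where k: "z - scale k w \<in> lower_central 2"
            unfolding span_breakdown_eq span_lc by blast
          obtain a b where u: "v - scale a x - scale b y \<in> lower_central 1"
            using decompose_insert2[OF subspace_lower_central, of v x y 1] full
            by (auto simp: insert_commute)
          have "bracket (v - scale a x - scale b y) w = 0"
            using metabelian_bracket_eq_0[OF assms(1)] u lower_central_member[of y 0 x]
            by (simp add: der w_def lower_central.simps(1))
          then have "bracket v z = scale (k * a) (bracket x w) + scale (k * b) (bracket y w)
              + bracket v (z - scale k w)"
            by (simp add: bracket_simps algebra_simps)
          moreover have "bracket y w \<in> lower_central 3"
            using yx subspace_neg[OF subspace_lower_central, of "bracket y (bracket y x)" 3]
            by (simp add: w_def bracket_commute[of x y] bracket_minus_right)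
          moreover have "bracket v (z - scale k w) \<in> lower_central 3"
            using lower_central_member[OF k] by (simp add: numeral_3_eq_3 numeral_2_eq_2)
          ultimately show ?thesis
            using True by (simp add: w_def subspace_lower_central subspace_add subspace_scale)
        qed
        then show ?thesis
          unfolding numeral_2_eq_2 lower_central.simps(2)[of "Suc 0"]
          by (intro product_space_least subspace_lower_central) simp
      qed
      \<comment> \<open>Strictness at index 2 requires \<open>3 < n\<close>, which is the dimension
        hypothesis.\<close>
      then show False using strict[of 2] n by (auto simp: numeral_3_eq_3 numeral_2_eq_2)
    qed
    have "y \<notin> lower_central 1"
      using y span_base[of y "insert x (lower_central 1)"] by blast
    moreover have "x \<notin> span (insert y (lower_central 1))"
      using in_span_insert[of x y "lower_central 1"] x y by (auto simp: span_lc)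
    ultimately show thesis
      using that[of y x] full gen[OF yx] nz[OF yx] unfolding der
      by (simp add: insert_commute)
  qed
qed

end

section \<open>Coordinate functionals modulo a subspace\<close>

text \<open>A basis of \<open>S\<close> together with \<open>x\<close> and \<open>y\<close> is a
  basis of the whole space; the functionals dual to \<open>x\<close> and \<open>y\<close> vanish on
  \<open>S\<close> and recover the coefficients.\<close>

lemma (in vector_space) coordinates_modulo_subspace:
  assumes S: "subspace S" and x: "x \<notin> S" and y: "y \<notin> span (insert x S)"
    and full: "span (insert y (insert x S)) = UNIV"
  obtains \<alpha> \<beta> where "Vector_Spaces.linear scale (*) \<alpha>" "\<And>u. u \<in> S \<Longrightarrow> \<alpha> u = 0"
    "Vector_Spaces.linear scale (*) \<beta>" "\<And>u. u \<in> S \<Longrightarrow> \<beta> u = 0"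
    "\<And>v. v - scale (\<alpha> v) x - scale (\<beta> v) y \<in> S"
    "\<alpha> x = 1" "\<beta> x = 0"
proof -
  interpret vector_space_pair scale "(*) :: 'a \<Rightarrow> 'a \<Rightarrow> 'a"
    by unfold_locales (simp_all add: algebra_simps)
  obtain C where C: "C \<subseteq> S" "independent C" "S \<subseteq> span C"
    by (rule maximal_independent_subset)
  have span_C: "span C = S"
    using C S by (simp add: span_minimal subset_antisym)
  have "span (insert x C) = span (insert x S)"
    using span_C S by (simp add: span_insert span_eq_iff[THEN iffD2, OF S])
  then have ind: "independent (insert y (insert x C))"
    using x y C(2) span_C by (auto simp: independent_insert intro: span_base)
  have "y \<noteq> x" using y by (auto intro: span_base)
  have "y \<notin> C" using y C(1) by (auto intro: span_base)
  have "x \<notin> C" using x C(1) by auto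
  obtain \<alpha> where \<alpha>: "Vector_Spaces.linear scale (*) \<alpha>" "\<forall>z\<in>insert y (insert x C). \<alpha> z = (if z = x then 1 else 0)"
    using linear_independent_extend[OF ind, of "\<lambda>z. if z = x then 1 else 0"] by blast
  obtain \<beta> where \<beta>: "Vector_Spaces.linear scale (*) \<beta>" "\<forall>z\<in>insert y (insert x C). \<beta> z = (if z = y then 1 else 0)"
    using linear_independent_extend[OF ind, of "\<lambda>z. if z = y then 1 else 0"] by blast
  have \<alpha>0: "\<alpha> u = 0" if "u \<in> S" for u
  proof (rule linear_eq_0_on_span[OF \<alpha>(1)])
    show "\<alpha> z = 0" if "z \<in> C" for z using \<alpha>(2) \<open>x \<notin> C\<close> that by auto
    show "u \<in> span C" using that span_C by simp
  qed
  have \<beta>0: "\<beta> u = 0" if "u \<in> S" for u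
  proof (rule linear_eq_0_on_span[OF \<beta>(1)])
    show "\<beta> z = 0" if "z \<in> C" for z using \<beta>(2) \<open>y \<notin> C\<close> that by auto
    show "u \<in> span C" using that span_C by simp
  qed
  have vals: "\<alpha> x = 1" "\<alpha> y = 0" "\<beta> x = 0" "\<beta> y = 1"
    using \<alpha>(2) \<beta>(2) \<open>y \<noteq> x\<close> by auto
  have "v - scale (\<alpha> v) x - scale (\<beta> v) y \<in> S" for v
  proof -
    obtain b a where u: "v - scale b y - scale a x \<in> S"
      using decompose_insert2[OF S, of v y x] full by auto
    have "\<alpha> v = a"
      using \<alpha>0[OF u] vals by (simp add: linear_diff[OF \<alpha>(1)] linear_scale[OF \<alpha>(1)])
    moreover have "\<beta> v = b"
      using \<beta>0[OF u] vals by (simp add: linear_diff[OF \<beta>(1)] linear_scale[OF \<beta>(1)])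
    ultimately show ?thesis using u by (simp add: algebra_simps)
  qed
  then show thesis
    using that[OF \<alpha>(1) \<alpha>0 \<beta>(1) \<beta>0] vals by blast
qed

section \<open>Preimages under the adjoint map of \<open>e1\<close>\<close>

context lie_algebra
begin

text \<open>If \<open>z\<close> is close to \<open>[e1, u]\<close> and \<open>x\<close> acts as
  \<open>a e1 + b e2\<close>, then \<open>[x, z]\<close> is close to
  \<open>[e1, a z + b [e2, u]]\<close>, because the adjoint maps of \<open>e1\<close> and
  \<open>e2\<close> commute on \<open>g\<^sup>1\<close>.\<close>

lemma lower_central_approx_image:
  assumes met: "metabelian"
    and full: "span (insert e2 (insert e1 derived_algebra)) = UNIV"
    and gen: "lower_central 2 = span (insert (bracket e1 (bracket e1 e2)) (lower_central 3))"
    and v: "v \<in> lower_central (Suc (Suc k))"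
  shows "\<exists>u\<in>lower_central (Suc k). v - bracket e1 u \<in> lower_central (Suc (Suc (Suc k)))"
  using v
proof (induction k arbitrary: v)
  case 0
  then have "v \<in> span (insert (bracket e1 (bracket e1 e2)) (lower_central 3))"
    using gen by (simp add: numeral_2_eq_2 del: lower_central.simps)
  then obtain c where "v - scale c (bracket e1 (bracket e1 e2)) \<in> lower_central 3"
    unfolding span_breakdown_eq span_eq_iff[THEN iffD2, OF subspace_lower_central] by blast
  moreover have "scale c (bracket e1 e2) \<in> lower_central (Suc 0)"
    by (intro subspace_scale subspace_lower_central lower_central_member) simp
  ultimately show ?case
    by (intro bexI[of _ "scale c (bracket e1 e2)"])
      (simp_all add: bracket_scale_right numeral_3_eq_3 del: lower_central.simps)
next
  case (Suc k)
  note [simp del] = lower_central.simps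
  let ?A = "lower_central (Suc (Suc k))" and ?C = "lower_central (Suc (Suc (Suc (Suc k))))"
  \<comment> \<open>The elements with an approximate preimage form a subspace, so brackets
    suffice.\<close>
  let ?P = "{v. \<exists>u\<in>?A. v - bracket e1 u \<in> ?C}"
  have "subspace ?P"
  proof (rule subspaceI)
    show "0 \<in> ?P"
      using subspace_0[OF subspace_lower_central] by (auto intro!: bexI[of _ 0] simp: bracket_zero_right)
  next
    fix x y assume "x \<in> ?P" "y \<in> ?P"
    then obtain u u' where u: "u \<in> ?A" "x - bracket e1 u \<in> ?C" and u': "u' \<in> ?A" "y - bracket e1 u' \<in> ?C"
      by blast
    have "x + y - bracket e1 (u + u') \<in> ?C"
      using subspace_add[OF subspace_lower_central u(2) u'(2)]
      by (simp add: bracket_add_right algebra_simps)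
    then show "x + y \<in> ?P"
      using subspace_add[OF subspace_lower_central u(1) u'(1)] by blast
  next
    fix c x assume "x \<in> ?P"
    then obtain u where u: "u \<in> ?A" "x - bracket e1 u \<in> ?C" by blast
    have "scale c x - bracket e1 (scale c u) \<in> ?C"
      using subspace_scale[OF subspace_lower_central u(2), of c]
      by (simp add: bracket_scale_right algebra_simps)
    then show "scale c x \<in> ?P"
      using subspace_scale[OF subspace_lower_central u(1)] by blast
  qed
  moreover have "bracket x z \<in> ?P" if z: "z \<in> ?A" for x z
  proof -
    obtain u where u: "u \<in> lower_central (Suc k)"
      and z': "z - bracket e1 u \<in> lower_central (Suc (Suc (Suc k)))"
      using Suc.IH[OF z] by blast
    obtain b a where ab: "x - scale b e2 - scale a e1 \<in> derived_algebra"
      using decompose_insert2[of derived_algebra x e2 e1] full subspace_lower_central[of 1]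
      by (auto simp: derived_algebra_eq)
    have zu: "z \<in> derived_algebra" "u \<in> derived_algebra"
      using z u lower_central_antimono[of 1] by (auto simp: derived_algebra_eq)
    have "bracket (x - scale b e2 - scale a e1) z = 0"
      by (rule metabelian_bracket_eq_0[OF met ab zu(1)])
    moreover have "bracket (bracket e2 e1) u = 0"
      using lower_central_member[of e1 0 e2]
      by (intro metabelian_bracket_eq_0[OF met _ zu(2)]) (simp add: derived_algebra_eq lower_central.simps(1))
    \<comment> \<open>\<open>ad e1\<close> and \<open>ad e2\<close> commute on the derived algebra\<close>
    then have "bracket e2 (bracket e1 u) = bracket e1 (bracket e2 u)"
      using bracket_derivation[of e2 e1 u] by simp
    \<comment> \<open>The error of the induction hypothesis moves one term further down under
      \<open>e2\<close>.\<close>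
    ultimately have "bracket x z - bracket e1 (scale a z + scale b (bracket e2 u))
        = scale b (bracket e2 (z - bracket e1 u))"
      by (simp add: bracket_simps algebra_simps)
    also have "\<dots> \<in> ?C"
      by (intro subspace_scale subspace_lower_central lower_central_member z')
    finally have "bracket x z - bracket e1 (scale a z + scale b (bracket e2 u)) \<in> ?C" .
    moreover have "scale a z + scale b (bracket e2 u) \<in> ?A"
      using z lower_central_member[OF u]
      by (intro subspace_add subspace_scale subspace_lower_central) auto
    ultimately show ?thesis by blast
  qed
  ultimately have "product_space bracket UNIV ?A \<subseteq> ?P"
    by (intro product_space_least) auto
  then show ?case
    using Suc.prems lower_central.simps(2)[of "Suc (Suc k)"] by blast
qed

text \<open>Successive approximation: each correction pushes the error one term down the series, and
  nilpotency makes it zero after finitely many rounds.\<close>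

lemma lower_central_2_image:
  assumes met: "metabelian" and "nilpotent"
    and full: "span (insert e2 (insert e1 derived_algebra)) = UNIV"
    and gen: "lower_central 2 = span (insert (bracket e1 (bracket e1 e2)) (lower_central 3))"
    and v: "v \<in> lower_central 2"
  shows "\<exists>u\<in>derived_algebra. v = bracket e1 u"
proof -
  note [simp del] = lower_central.simps
  have approx: "\<exists>u\<in>derived_algebra. v - bracket e1 u \<in> lower_central (Suc (Suc j))" for j
  proof (induction j)
    case 0
    have "0 \<in> derived_algebra"
      unfolding derived_algebra_eq by (rule subspace_0[OF subspace_lower_central])
    then show ?case
      using v by (intro bexI[of _ 0]) (simp_all add: bracket_zero_right numeral_2_eq_2)
  next
    case (Suc j)
    then obtain u where u: "u \<in> derived_algebra" "v - bracket e1 u \<in> lower_central (Suc (Suc j))"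
      by blast
    obtain u' where u': "u' \<in> lower_central (Suc j)"
        "v - bracket e1 u - bracket e1 u' \<in> lower_central (Suc (Suc (Suc j)))"
      using lower_central_approx_image[OF met full gen u(2)] by blast
    have "u + u' \<in> derived_algebra"
      using u(1) u'(1) lower_central_antimono[of 1 "Suc j"] subspace_add[OF subspace_lower_central]
      by (auto simp: derived_algebra_eq)
    then show ?case
      using u'(2) by (intro bexI[of _ "u + u'"]) (simp_all add: bracket_add_right algebra_simps)
  qed
  obtain m where "lower_central m = {0}"
    using \<open>nilpotent\<close> unfolding nilpotent_def by blast
  then have "lower_central (Suc (Suc m)) \<subseteq> {0}"
    using lower_central_antimono[of m "Suc (Suc m)"] by simp
  then show ?thesis using approx[of m] by (metis eq_iff_diff_eq_0 singletonD subsetD)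
qed

section \<open>Assembly of the product and its non-associativity\<close>

theorem nonassociative_cpa_structure_exists:
  assumes met: "metabelian" and fil: "filiform" and dim: "dim UNIV \<ge> 4"
  shows "\<exists>prd. cpa_structure scale bracket prd \<and> \<not> cpa_structure.associative scale bracket prd"
proof -
  note [simp del] = lower_central.simps
  obtain e1 e2 where e: "e1 \<notin> derived_algebra" "e2 \<notin> span (insert e1 derived_algebra)"
    and full: "span (insert e2 (insert e1 derived_algebra)) = UNIV"
    and gen: "lower_central 2 = span (insert (bracket e1 (bracket e1 e2)) (lower_central 3))"
    and nz: "bracket e1 (bracket e1 e2) \<noteq> 0"
    by (rule adapted_pair_exists[OF met fil dim])
  have sub: "subspace derived_algebra"
    by (simp add: derived_algebra_eq subspace_lower_central)
  have w: "bracket e1 e2 \<in> derived_algebra"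
    by (simp add: derived_algebra_def product_space_member)
  obtain \<alpha> \<beta> where \<alpha>: "Vector_Spaces.linear scale (*) \<alpha>" "\<And>u. u \<in> derived_algebra \<Longrightarrow> \<alpha> u = 0"
    and \<beta>: "Vector_Spaces.linear scale (*) \<beta>" "\<And>u. u \<in> derived_algebra \<Longrightarrow> \<beta> u = 0"
    and coord: "\<And>v. v - scale (\<alpha> v) e1 - scale (\<beta> v) e2 \<in> derived_algebra"
    and e1: "\<alpha> e1 = 1" "\<beta> e1 = 0"
    by (rule coordinates_modulo_subspace[OF sub e full]) blast
  have "bracket e2 (bracket e1 e2) \<in> lower_central 2"
    using lower_central_member[of "bracket e1 e2" 1 e2] w
    by (simp add: derived_algebra_eq numeral_2_eq_2)
  then obtain q where q: "q \<in> derived_algebra" "bracket e1 q = bracket e2 (bracket e1 e2)"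
    using lower_central_2_image[OF met _ full gen] fil unfolding filiform_def by metis
  define prd where "prd = (\<lambda>x y. bracket (scale 2 (scale (\<alpha> x) e1 + scale (\<beta> x) e2) - x) y
      + scale (2 * \<beta> x) (scale (\<alpha> y) (bracket e1 e2) + scale (\<beta> y) q))"
  have cpa: "cpa_structure scale bracket prd"
    unfolding prd_def by (rule cpa_structure_of_coordinates[OF met \<alpha> \<beta> coord q])
  \<comment> \<open>As \<open>e1\<close> has coordinates 1 and 0, the first factor is
    \<open>2 e1 - e1\<close> and the correction vanishes.\<close>
  have "prd e1 (bracket e1 e2) = bracket e1 (bracket e1 e2)"
    by (simp add: prd_def e1 scale_2)
  then have "product_space prd UNIV derived_algebra \<noteq> {0}"
    using product_space_member[OF UNIV_I[of e1] w, of prd] nz by auto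
  then show ?thesis
    using cpa cpa_structure.associative_def[OF cpa] by blast
qed

end

theorem proposition3p7:
  fixes scale :: "complex \<Rightarrow> 'v::ab_group_add \<Rightarrow> 'v"
    and bracket :: "'v \<Rightarrow> 'v \<Rightarrow> 'v"
    and n :: nat
  assumes "lie_algebra scale bracket"
    and "lie_algebra.metabelian scale bracket"
    and "lie_algebra.filiform scale bracket"
    and "vector_space.dim scale (UNIV :: 'v set) = n"
    and "n \<ge> 4"
  shows "\<exists>prd. cpa_structure scale bracket prd \<and> \<not> cpa_structure.associative scale bracket prd"
  using lie_algebra.nonassociative_cpa_structure_exists[OF assms(1-3)] assms(4,5) by simp

end
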